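(* Let $n,M\ge1$ be integers, let $R$ be an integer, and let $x_1,\ldots,x_n,m$ be nonnegative integers. Let $A_{R,M}(x_1,\ldots,x_n;m)$ denote the number of $n$-tuples $(\mu_1,\ldots,\mu_n)$, where each $\mu_r$ is a partition into $x_r$ distinct parts, $\mu_1$ is a partition into distinct parts congruent to $R$ modulo $M$, and the sum of all of the parts of all the $\mu_r$ is $m$. Let $B_{R,M}(x_1,\ldots,x_n;m)$ denote the number of colored partitions $\lambda_1+\cdots+\lambda_s$ of $m$ counted by $B(x_1,\ldots,x_n;m)$ (defined in the context) such that (i) if $\lambda_S$ denotes the smallest part with odd color, then $$\lambda_S\equiv R+\sum_{\ell=S}^{s}\omega_e(c_\ell)\pmod M,$$ and (ii) if $\lambda_i\ge\lambda_j$ (with $i<j$) are any two parts with odd color, then $$\lambda_i\equiv\lambda_j+\sum_{\ell=i}^{j-1}\omega_e(c_\ell)\pmod M.$$ Then $A_{R,M}(x_1,\ldots,x_n;m)=B_{R,M}(x_1,\ldots,x_n;m)$.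
   Context: All parts of partitions are positive integers; the empty partition is allowed. In a colored partition each part is a positive integer (its size) together with a color, and the parts are written in decreasing order $\lambda_1,\ldots,\lambda_s$, ordered first by size and then by color; "distinct" means that no (size, color) pair is repeated. In inequalities and congruences $\lambda_i$ denotes the size of the $i$-th part and $c_i$ its color. For a positive integer $c$: $\omega(c)$ is the number of powers of $2$ occurring in the binary representation of $c$; $\omega_e(c)$ is the number of even powers of $2$, i.e. those among $2,4,8,\ldots$ (all powers of $2$ other than $1$), occurring in the binary representation of $c$; $v(c)$ (resp. $z(c)$) is the smallest (resp. largest) power of $2$ occurring in the binary representation of $c$. The function $\delta(c,d)$ equals $1$ if $z(c)<v(d)$ and $0$ otherwise. $B(x_1,\ldots,x_n;m)$ denotes the number of partitions $\lambda_1+\cdots+\lambda_s$ of $m$ into distinct parts occurring in $2^n-1$ colors ($c_i\in\{1,\ldots,2^n-1\}$) such that $\lambda_s\ge\omega(c_s)$; for each $1\le r\le n$ exactly $x_r$ of the colors $c_i$ have $2^{r-1}$ in their binary representations; and $\lambda_i-\lambda_{i+1}\ge\omega(c_i)+\delta(c_i,c_{i+1})$ for all $1\le i<s$. If there is no part of odd color, condition (i) in the claim is vacuous. *)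

theory Defs
  imports "HOL-Number_Theory.Cong" "HOL-Library.FuncSet"
begin

text \<open>A partition is the list of its parts in decreasing order; the empty list is allowed.\<close>

definition is_partition :: "nat list \<Rightarrow> bool" where
  "is_partition p \<longleftrightarrow> sorted_wrt (\<ge>) p \<and> (\<forall>a\<in>set p. 0 < a)"

definition distinct_partitions :: "nat \<Rightarrow> nat list set" where
  "distinct_partitions k = {p. is_partition p \<and> distinct p \<and> length p = k}"


text \<open>The functions \<open>vmin\<close> and \<open>zmax\<close> return powers of two, not exponents. All five
  functions on colors below are only meant for positive arguments.\<close>

definition binary_powers :: "nat \<Rightarrow> nat set" where
  "binary_powers c = {2 ^ k |k. bit c k}"

definition omega :: "nat \<Rightarrow> nat" where
  "omega c = card (binary_powers c)"

definition omega_e :: "nat \<Rightarrow> nat" where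
  "omega_e c = card {q \<in> binary_powers c. even q}"

definition vmin :: "nat \<Rightarrow> nat" where
  "vmin c = Min (binary_powers c)"

definition zmax :: "nat \<Rightarrow> nat" where
  "zmax c = Max (binary_powers c)"

definition delta :: "nat \<Rightarrow> nat \<Rightarrow> nat" where
  "delta c d = (if zmax c < vmin d then 1 else 0)"


text \<open>A colored part is a pair (size, color). Lists are indexed from 0, so the part
  $\lambda_i$ is the entry at position $i - 1$.\<close>

type_synonym cpart = "nat \<times> nat"

abbreviation size_at :: "cpart list \<Rightarrow> nat \<Rightarrow> nat" where
  "size_at l i \<equiv> fst (l ! i)"

abbreviation color_at :: "cpart list \<Rightarrow> nat \<Rightarrow> nat" where
  "color_at l i \<equiv> snd (l ! i)"

definition cpart_ge :: "cpart \<Rightarrow> cpart \<Rightarrow> bool" where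
  "cpart_ge p q \<longleftrightarrow> fst p > fst q \<or> fst p = fst q \<and> snd p \<ge> snd q"

definition is_colored_partition :: "nat \<Rightarrow> cpart list \<Rightarrow> bool" where
  "is_colored_partition n l \<longleftrightarrow>
     sorted_wrt cpart_ge l \<and> (\<forall>p\<in>set l. 0 < fst p \<and> snd p \<in> {1..2 ^ n - 1})"


definition B_set :: "nat \<Rightarrow> (nat \<Rightarrow> nat) \<Rightarrow> nat \<Rightarrow> cpart list set" where
  "B_set n x m =
     {l. is_colored_partition n l \<and> distinct l \<and> sum_list (map fst l) = m \<and>
         (l \<noteq> [] \<longrightarrow> fst (last l) \<ge> omega (snd (last l))) \<and>
         (\<forall>r\<in>{1..n}. card {i. i < length l \<and> 2 ^ (r - 1) \<in> binary_powers (color_at l i)} = x r) \<and>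
         (\<forall>i. i + 1 < length l \<longrightarrow>
            int (size_at l i) - int (size_at l (i + 1))
              \<ge> int (omega (color_at l i) + delta (color_at l i) (color_at l (i + 1))))}"

definition smallest_odd_cond :: "int \<Rightarrow> nat \<Rightarrow> cpart list \<Rightarrow> bool" where
  "smallest_odd_cond R M l \<longleftrightarrow>
     (\<forall>S < length l. odd (color_at l S) \<and>
        (\<forall>j < length l. odd (color_at l j) \<longrightarrow> size_at l S \<le> size_at l j) \<longrightarrow>
        [int (size_at l S) = R + int (\<Sum>k\<in>{S..<length l}. omega_e (color_at l k))] (mod int M))"

definition odd_pairs_cond :: "nat \<Rightarrow> cpart list \<Rightarrow> bool" where
  "odd_pairs_cond M l \<longleftrightarrow>
     (\<forall>i j. i < j \<and> j < length l \<and> odd (color_at l i) \<and> odd (color_at l j) \<longrightarrow>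
        [int (size_at l i) = int (size_at l j) + int (\<Sum>k\<in>{i..<j}. omega_e (color_at l k))]
          (mod int M))"

definition B_RM :: "int \<Rightarrow> nat \<Rightarrow> nat \<Rightarrow> (nat \<Rightarrow> nat) \<Rightarrow> nat \<Rightarrow> nat" where
  "B_RM R M n x m = card {l \<in> B_set n x m. smallest_odd_cond R M l \<and> odd_pairs_cond M l}"


text \<open>The tuples $(\mu_1,\ldots,\mu_n)$ are the extensional functions on \<open>{1..n}\<close>.\<close>

definition A_RM :: "int \<Rightarrow> nat \<Rightarrow> nat \<Rightarrow> (nat \<Rightarrow> nat) \<Rightarrow> nat \<Rightarrow> nat" where
  "A_RM R M n x m =
     card {mu \<in> (\<Pi>\<^sub>E r\<in>{1..n}. distinct_partitions (x r)).
             (\<forall>a\<in>set (mu 1). [int a = R] (mod int M)) \<and>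
             (\<Sum>r\<in>{1..n}. sum_list (mu r)) = m}"

end

theory Submission
  imports Defs "HOL-Library.Product_Lexorder" "HOL-Library.Nat_Bijection"
    "HOL-Computational_Algebra.Polynomial"
begin

text \<open>
Subtract from every part $\lambda_i$ of a colored partition the number $\omega(c_i)$ and the numbers
$\omega_e(c_j)$ with $j > i$; call the result the level $a_i$. The level is a natural number, the gap
condition becomes a condition on the levels alone, namely that $a_i \ge a_{i+1}$, strictly if
$c_{i+1}$ is odd or $\delta(c_i, c_{i+1}) = 1$ (lemma \<open>chain_iff_gaps\<close>), and conditions (i) and (ii)
together say that $a_i + 1 \equiv R$ modulo $M$ for every odd $c_i$ (lemma \<open>congruence_parts\<close>). Blocks of
odd color have distinct levels. So these numbers $a_i + 1$ form a partition into distinct parts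
congruent to $R$, and it is natural to take it for $\mu_1$. What remains has nothing to do with $R$ and
$M$: the odd levels may be prescribed arbitrarily.

The other binary digits of the colors, read from the largest part to the smallest and increasingly
within each color, form a word $b$ in the letters $1, \ldots, n - 1$, where the letter $r - 1$ stands for
$2^{r-1}$. On the other side, merging $\mu_2, \ldots, \mu_n$ into a lexicographically increasing list of pairs
(part, label) also gives a word, the word of labels. For each word $b$ of length $N$ and each set of odd
levels the two sides are equally numerous, because they have the same generating function: a power of
$q$ that depends on the descents of $b$, times $q^{\sum(a_i+1)}$ over the odd levels, times a
Gaussian binomial coefficient, which tends to $1/((1-q)\cdots(1-q^N))$ when the bound on the levels
grows.

For the lists of pairs this is the usual removal of the forced increments (lemma \<open>capped_lists_gf\<close>).
For colored partitions (lemma \<open>chains_gf\<close>) the point is that $\delta$ makes the division of the word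
into colors automatic: among the blocks without digit 0 at one level, a new color starts exactly at the
weak descents of the word. Building the partition letter by letter from the highest level
downwards, one has at each moment a current block, which either takes the next letter (at an ascent),
or is followed by a new block of the same level (at a descent), or is followed by a drop of the level.
The cases of an ascent and of a descent obey the two different Pascal rules of the Gaussian
coefficients, and a level with an odd block obeys the first rule instead of the second.
This is why neither the descents nor the odd levels affect the Gaussian factor.\<close>

section \<open>Gaussian binomial coefficients\<close>

text \<open>The Gaussian binomial coefficient with upper entry $N + L - 1$ and lower entry $N$: it enumerates
the multisets of $N$ elements of $\{0, \ldots, L - 1\}$ by their sum.\<close>

fun gauss :: "'a::comm_semiring_1 \<Rightarrow> nat \<Rightarrow> nat \<Rightarrow> 'a" where
  "gauss q 0 L = 1"
| "gauss q (Suc N) 0 = 0"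
| "gauss q (Suc N) (Suc L) = gauss q N (Suc L) + q ^ Suc N * gauss q (Suc N) L"

text \<open>The defining recursion is one of the two Pascal rules; this is the other one. Chains of blocks need
both: a letter that extends the current block obeys the first rule, a letter that opens a new block
obeys the second.\<close>

lemma gauss_Suc_Suc':
  "gauss q (Suc N) (Suc L) = q ^ L * gauss q N (Suc L) + gauss q (Suc N) L"
proof (induction "N + L" arbitrary: N L rule: less_induct)
  case less
  show ?case
  proof (cases N)
    case 0
    show ?thesis
    proof (cases L)
      case (Suc L')
      have a: "gauss q (Suc 0) (Suc L') = q ^ L' + gauss q (Suc 0) L'"
        using less[of 0 L'] 0 Suc by simp
      have "gauss q (Suc 0) (Suc L) = 1 + q * gauss q (Suc 0) (Suc L')"
        using Suc by simp
      also have "\<dots> = q ^ L + (1 + q * gauss q (Suc 0) L')"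
        unfolding a by (simp add: Suc algebra_simps)
      finally show ?thesis using 0 Suc by simp
    qed (use 0 in simp)
  next
    case N: (Suc N')
    show ?thesis
    proof (cases L)
      case 0
      have "gauss q (Suc N') (Suc 0) = q ^ 0 * gauss q N' (Suc 0) + gauss q (Suc N') 0"
        using less[of N' 0] N 0 by simp
      then show ?thesis using N 0 by simp
    next
      case (Suc L')
      have a: "gauss q (Suc N') (Suc L) = q ^ L * gauss q N' (Suc L) + gauss q (Suc N') L"
        using less[of N' L] N by simp
      have b: "gauss q (Suc N) L = q ^ L' * gauss q N L + gauss q (Suc N) L'"
        using less[of N L'] Suc by simp
      have c: "gauss q (Suc N) L = gauss q N L + q ^ Suc N * gauss q (Suc N) L'"
        using Suc by simp
      have d: "gauss q N (Suc L) = gauss q N' (Suc L) + q ^ N * gauss q N L"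
        using N by simp
      have "gauss q (Suc N) (Suc L) = gauss q N (Suc L) + q ^ Suc N * gauss q (Suc N) L"
        by simp
      also have "\<dots> = (q ^ L * gauss q N' (Suc L) + gauss q N L)
          + q ^ Suc N * (q ^ L' * gauss q N L + gauss q (Suc N) L')"
        using a b N by simp
      also have "\<dots> = q ^ L * (gauss q N' (Suc L) + q ^ N * gauss q N L)
          + (gauss q N L + q ^ Suc N * gauss q (Suc N) L')"
        by (simp add: Suc algebra_simps)
      finally show ?thesis unfolding c[symmetric] d[symmetric] .
    qed
  qed
qed

text \<open>Iterating the first rule splits the multisets according to their smallest element $g$.\<close>

lemma gauss_Suc_sum:
  "gauss q (Suc N) (Suc L) = (\<Sum>g\<le>L. q ^ (g * Suc N) * gauss q N (Suc (L - g)))"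
proof (induction L)
  case (Suc L)
  have "(\<Sum>g\<le>Suc L. q ^ (g * Suc N) * gauss q N (Suc (Suc L - g)))
     = gauss q N (Suc (Suc L)) + (\<Sum>g\<le>L. q ^ (Suc g * Suc N) * gauss q N (Suc (L - g)))"
    by (subst sum.atMost_Suc_shift) simp
  also have "(\<Sum>g\<le>L. q ^ (Suc g * Suc N) * gauss q N (Suc (L - g)))
     = q ^ Suc N * (\<Sum>g\<le>L. q ^ (g * Suc N) * gauss q N (Suc (L - g)))"
    by (simp add: sum_distrib_left power_add mult_ac)
  finally show ?case using Suc by simp
qed simp

text \<open>The least possible sum of values $y_1 + \cdots + y_N$ such that the pairs
$(0, z), (y_1, b_1), \ldots, (y_N, b_N)$ increase lexicographically: each weak descent of \<open>z # b\<close> forces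
the values to grow by one from there on.\<close>

fun descent_weight :: "nat \<Rightarrow> nat list \<Rightarrow> nat" where
  "descent_weight z [] = 0"
| "descent_weight z (y # b) = (if z < y then 0 else Suc (length b)) + descent_weight y b"

section \<open>Chains of blocks\<close>

text \<open>A block \<open>(a, bs)\<close> stands for a part whose color has the binary digits at the positions \<open>bs\<close>, listed
increasingly. Its level \<open>a\<close> is the size of the part after subtracting $\omega$ of its color and
$\omega_e$ of all the later colors. Positions other than 0 are called letters; reading the blocks
from left to right gives the word of the chain.\<close>

type_synonym block = "nat \<times> nat list"

fun word :: "block list \<Rightarrow> nat list" where
  "word [] = []"
| "word ((a, bs) # t) = filter (\<lambda>k. 0 < k) bs @ word t"

fun odd_levels :: "block list \<Rightarrow> nat list" where
  "odd_levels [] = []"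
| "odd_levels ((a, bs) # t) = (if 0 \<in> set bs then a # odd_levels t else odd_levels t)"

text \<open>The gap condition in terms of levels. \<open>L\<close> and \<open>z\<close> are the level and the last digit position of the
preceding block. Levels decrease weakly, and they must drop before a block that has the digit 0 or
that starts above \<open>z\<close> (the case $\delta = 1$). Hence within one level the boundaries between blocks
without digit 0 are exactly the weak descents of the word. With \<open>z = 0\<close> a drop below \<open>L\<close> is always
enforced, so \<open>L\<close> is then a strict upper bound for the levels.\<close>

fun block_chain :: "nat \<Rightarrow> nat \<Rightarrow> block list \<Rightarrow> bool" where
  "block_chain L z [] \<longleftrightarrow> True"
| "block_chain L z ((a, bs) # t) \<longleftrightarrow> bs \<noteq> [] \<and> sorted_wrt (<) bs \<and>
     a + (if 0 < hd bs \<and> hd bs \<le> z then 0 else 1) \<le> L \<and> block_chain a (last bs) t"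

text \<open>The sum of the sizes of the parts that the blocks stand for, so that each letter counts once for
its own block and once for every earlier block.\<close>

fun weight :: "block list \<Rightarrow> nat" where
  "weight [] = 0"
| "weight ((a, bs) # t) = a + length bs + length (word t) + weight t"

definition block_chains :: "nat \<Rightarrow> nat list \<Rightarrow> nat list \<Rightarrow> block list set" where
  "block_chains L b D = {t. block_chain L 0 t \<and> word t = b \<and> odd_levels t = D}"

text \<open>The ways to continue a chain whose current block lies at level \<open>L\<close>, has last digit position \<open>z\<close> so far,
and may still be extended: \<open>v\<close> are the digits added to this block, and \<open>t\<close> are the later blocks. Since
the weight of \<open>t\<close> alone is counted below, letters in \<open>v\<close> contribute 0 and the block after the current
one acts as the first.\<close>

definition open_chains :: "nat \<Rightarrow> nat \<Rightarrow> nat list \<Rightarrow> nat list \<Rightarrow> (nat list \<times> block list) set" where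
  "open_chains L z b D = {(v, t). sorted_wrt (<) (z # v) \<and> block_chain L (last (z # v)) t \<and>
     v @ word t = b \<and> odd_levels t = D}"

lemma filter_pos_sorted:
  "sorted_wrt (<) (k # v) \<Longrightarrow> filter (\<lambda>k. 0 < k) v = (v :: nat list)"
  by (auto simp: filter_id_conv)

text \<open>The digit 0 can only come first in a block, and deleting it leaves the letters.\<close>

lemma block_cases:
  assumes "bs \<noteq> []" "sorted_wrt (<) (bs :: nat list)"
  obtains v where "bs = 0 # v" "filter (\<lambda>k. 0 < k) bs = v"
  | k v where "bs = k # v" "0 < k" "0 \<notin> set bs" "filter (\<lambda>k. 0 < k) bs = bs"
proof (cases bs)
  case (Cons k v)
  show ?thesis
  proof (cases "k = 0")
    case True
    then show ?thesis using that(1)[of v] Cons assms filter_pos_sorted[of k v] by simp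
  next
    case False
    then show ?thesis using that(2)[of k v] Cons assms filter_pos_sorted[of k v] by force
  qed
qed (use assms in simp)

lemma chain_mono: "block_chain L z t \<Longrightarrow> L \<le> L' \<Longrightarrow> block_chain L' z t"
  by (cases t) (auto split: if_splits)

lemma odd_levels_chain:
  "block_chain L z t \<Longrightarrow> sorted_wrt (>) (odd_levels t) \<and> (\<forall>d\<in>set (odd_levels t). d < L)"
proof (induction L z t rule: block_chain.induct)
  case (2 L z a bs t)
  then show ?case
    by (cases bs) (auto split: if_splits)
qed simp

text \<open>A first block that starts above \<open>z\<close> or has the digit 0 must drop below level \<open>L\<close> anyway, so \<open>z\<close> does
not matter.\<close>

lemma chain_0_iff:
  assumes "word t = [] \<or> z < hd (word t)"
  shows "block_chain L z t \<longleftrightarrow> block_chain L 0 t"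
proof (cases t)
  case (Cons p t')
  obtain a bs where p: "p = (a, bs)" by force
  show ?thesis
  proof (cases "bs \<noteq> [] \<and> sorted_wrt (<) bs")
    case True
    then have "bs \<noteq> []" "sorted_wrt (<) bs" by auto
    then show ?thesis
      by (cases rule: block_cases) (use assms Cons p in auto)
  qed (auto simp: Cons p)
qed simp

text \<open>At a weak descent a new block may stay at level \<open>L\<close>, exactly as if levels were only bounded by
\<open>Suc L\<close>. A block with digit 0 cannot profit from the larger bound, because the odd levels are
assumed to lie below \<open>L\<close>.\<close>

lemma chain_Suc_iff:
  assumes "word t = y # b" "y \<le> z" "\<forall>d\<in>set (odd_levels t). d < L"
  shows "block_chain L z t \<longleftrightarrow> block_chain (Suc L) 0 t"
proof (cases t)
  case (Cons p t')
  obtain a bs where p: "p = (a, bs)" by force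
  show ?thesis
  proof (cases "bs \<noteq> [] \<and> sorted_wrt (<) bs")
    case True
    then have "bs \<noteq> []" "sorted_wrt (<) bs" by auto
    then show ?thesis
      by (cases rule: block_cases) (use assms Cons p in auto)
  qed (auto simp: Cons p)
qed simp

section \<open>Decomposition by the highest level\<close>

lemma chains_0: "block_chains 0 b D = (if b = [] \<and> D = [] then {[]} else {})"
proof -
  have 0: "block_chain 0 0 t \<longleftrightarrow> t = []" for t
    by (cases t) (auto split: if_splits)
  show ?thesis by (auto simp: block_chains_def 0)
qed

text \<open>If \<open>L\<close> is an odd level, its block comes first: every block before it would have a level above \<open>L\<close>.
Its letters are then an initial ascending run of the word, as in an open block whose last digit is
0.\<close>

lemma chains_Suc_odd:
  "block_chains (Suc L) b (L # D) = (\<lambda>(v, t). (L, 0 # v) # t) ` open_chains L 0 b D" (is "?A = ?B")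
proof (intro set_eqI iffI)
  fix t assume "t \<in> ?A"
  then have t: "block_chain (Suc L) 0 t" "word t = b" "odd_levels t = L # D"
    by (auto simp: block_chains_def)
  then obtain a bs t' where [simp]: "t = (a, bs) # t'" by (cases t) auto
  from t have bs: "bs \<noteq> []" "sorted_wrt (<) bs" by auto
  from bs show "t \<in> ?B"
  proof (cases rule: block_cases)
    case (1 v)
    then have "(v, t') \<in> open_chains L 0 b D"
      using t bs by (auto simp: open_chains_def)
    then show ?thesis using 1 t by force
  next
    case (2 k v)
    then have "odd_levels t' = L # D" "block_chain a (last bs) t'" "a \<le> L" using t by auto
    then show ?thesis using odd_levels_chain[of a "last bs" t'] by auto
  qed
next
  fix t assume "t \<in> ?B"
  then obtain v t' where "t = (L, 0 # v) # t'" "(v, t') \<in> open_chains L 0 b D" by auto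
  then show "t \<in> ?A"
    using filter_pos_sorted[of 0 v] by (auto simp: block_chains_def open_chains_def)
qed

lemma chains_Suc_Nil:
  assumes "\<forall>d\<in>set D. d < L"
  shows "block_chains (Suc L) [] D = block_chains L [] D"
proof -
  have "block_chain L 0 t" if "block_chain (Suc L) 0 t" "word t = []" "\<forall>d\<in>set (odd_levels t). d < L" for t
  proof (cases t)
    case (Cons p t')
    obtain a bs where p: "p = (a, bs)" by force
    from that have "bs \<noteq> []" "sorted_wrt (<) bs" by (auto simp: Cons p)
    then show ?thesis
      by (cases rule: block_cases) (use that Cons p in auto)
  qed simp
  then show ?thesis using assms chain_mono[of L 0 _ "Suc L"] by (auto simp: block_chains_def)
qed

text \<open>If \<open>L\<close> is not an odd level, then either level \<open>L\<close> is empty, or the first letter opens a block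
there.\<close>

lemma chains_Suc_Cons:
  assumes "\<forall>d\<in>set D. d < L" "0 < y"
  shows "block_chains (Suc L) (y # b) D =
    block_chains L (y # b) D \<union> (\<lambda>(v, t). (L, y # v) # t) ` open_chains L y b D" (is "?A = _ \<union> ?B")
proof (intro set_eqI iffI)
  fix t assume "t \<in> ?A"
  then have t: "block_chain (Suc L) 0 t" "word t = y # b" "odd_levels t = D"
    by (auto simp: block_chains_def)
  then obtain a bs t' where [simp]: "t = (a, bs) # t'" by (cases t) auto
  from t have bs: "bs \<noteq> []" "sorted_wrt (<) bs" by auto
  from bs show "t \<in> block_chains L (y # b) D \<union> ?B"
  proof (cases rule: block_cases)
    case (1 v)
    then show ?thesis using t assms by (auto simp: block_chains_def)
  next
    case (2 k v)
    show ?thesis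
    proof (cases "a = L")
      case True
      then have "(v, t') \<in> open_chains L y b D" "k = y"
        using t bs 2 by (auto simp: open_chains_def)
      then show ?thesis using 2 True by force
    next
      case False
      then show ?thesis using t by (auto simp: block_chains_def)
    qed
  qed
next
  fix t assume "t \<in> block_chains L (y # b) D \<union> ?B"
  then consider "t \<in> block_chains L (y # b) D"
    | v t' where "t = (L, y # v) # t'" "(v, t') \<in> open_chains L y b D" by auto
  then show "t \<in> ?A"
  proof cases
    case 1
    then show ?thesis using chain_mono[of L 0 t "Suc L"] by (auto simp: block_chains_def)
  next
    case 2
    then show ?thesis
      using filter_pos_sorted[of y v] assms by (auto simp: block_chains_def open_chains_def)
  qed
qed

lemma open_chains_Nil: "open_chains L z [] D = Pair [] ` block_chains L [] D"
  using chain_0_iff[of _ z L] by (auto simp: open_chains_def block_chains_def)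

text \<open>A letter above \<open>z\<close> either joins the current block or forces a drop of the level.\<close>

lemma open_chains_ascent:
  assumes "z < y"
  shows "open_chains L z (y # b) D =
    Pair [] ` block_chains L (y # b) D \<union> (\<lambda>(v, t). (y # v, t)) ` open_chains L y b D" (is "?A = ?B \<union> ?C")
proof (intro set_eqI iffI)
  fix p assume "p \<in> ?A"
  moreover obtain v t where p: "p = (v, t)" by force
  ultimately have vt: "sorted_wrt (<) (z # v)" "block_chain L (last (z # v)) t" "v @ word t = y # b"
    "odd_levels t = D" by (auto simp: open_chains_def)
  show "p \<in> ?B \<union> ?C"
  proof (cases v)
    case Nil
    then show ?thesis using vt p chain_0_iff[of t z L] assms by (auto simp: block_chains_def)
  next
    case (Cons k v')
    then have "(v', t) \<in> open_chains L y b D" "k = y"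
      using vt by (auto simp: open_chains_def)
    then show ?thesis using p Cons by force
  qed
next
  fix p assume "p \<in> ?B \<union> ?C"
  then consider t where "p = ([], t)" "t \<in> block_chains L (y # b) D"
    | v t where "p = (y # v, t)" "(v, t) \<in> open_chains L y b D" by auto
  then show "p \<in> ?A"
  proof cases
    case 1
    then show ?thesis using chain_0_iff[of t z L] assms by (auto simp: block_chains_def open_chains_def)
  next
    case 2
    then show ?thesis using assms by (auto simp: open_chains_def)
  qed
qed

text \<open>A letter that is at most \<open>z\<close> cannot join the current block, which is therefore complete.\<close>

lemma open_chains_descent:
  assumes "\<forall>d\<in>set D. d < L" "y \<le> z"
  shows "open_chains L z (y # b) D = Pair [] ` block_chains (Suc L) (y # b) D"
proof -
  have "v = []" if "sorted_wrt (<) (z # v)" "v @ w = y # b" for v w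
    using that assms by (cases v) auto
  then show ?thesis
    using chain_Suc_iff[of _ y b z L] assms
    by (fastforce simp: open_chains_def block_chains_def image_iff)
qed

section \<open>The generating function of chains with a given word\<close>

text \<open>A block opened at level \<open>L\<close> has weight \<open>L\<close> plus one for each letter from it on, which produces the
factor $q^L$ of the second Pascal rule.\<close>

lemma chains_gf_step:
  fixes q :: "'a :: comm_semiring_1"
  assumes K: "finite (block_chains L (y # b) D)"
    "(\<Sum>t\<in>block_chains L (y # b) D. q ^ weight t) =
       q ^ (s + Suc (length b) + descent_weight y b) * gauss q (Suc (length b)) L"
  and J: "finite (open_chains L y b D)"
    "(\<Sum>(v, t)\<in>open_chains L y b D. q ^ weight t) =
       q ^ (s + descent_weight y b) * gauss q (length b) (Suc L)"
  and D: "\<forall>d\<in>set D. d < L" "0 < y"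
  shows "finite (block_chains (Suc L) (y # b) D)"
    "(\<Sum>t\<in>block_chains (Suc L) (y # b) D. q ^ weight t) =
       q ^ (s + Suc (length b) + descent_weight y b) * gauss q (Suc (length b)) (Suc L)"
proof -
  let ?f = "\<lambda>(v, t). (L, y # v) # t"
  show "finite (block_chains (Suc L) (y # b) D)"
    using K J by (simp add: chains_Suc_Cons[OF D])
  have disj: "block_chains L (y # b) D \<inter> ?f ` open_chains L y b D = {}"
    by (auto simp: block_chains_def split: if_splits)
  have "(\<Sum>t\<in>?f ` open_chains L y b D. q ^ weight t)
      = (\<Sum>p\<in>open_chains L y b D. q ^ weight (?f p))"
    by (subst sum.reindex) (auto simp: inj_on_def)
  also have "\<dots> = (\<Sum>p\<in>open_chains L y b D. q ^ (L + Suc (length b)) * (case p of (v, t) \<Rightarrow> q ^ weight t))"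
    by (rule sum.cong) (auto simp: open_chains_def power_add mult_ac)
  also have "\<dots> = q ^ (L + Suc (length b)) * (q ^ (s + descent_weight y b) * gauss q (length b) (Suc L))"
    by (simp add: sum_distrib_left[symmetric] J)
  finally show "(\<Sum>t\<in>block_chains (Suc L) (y # b) D. q ^ weight t) =
       q ^ (s + Suc (length b) + descent_weight y b) * gauss q (Suc (length b)) (Suc L)"
    unfolding gauss_Suc_Suc' chains_Suc_Cons[OF D]
    using K J disj by (simp add: sum.union_disjoint algebra_simps power_add)
qed

text \<open>Ascents use the first Pascal rule and descents use the second one. The two resulting recursions have
solutions of the same shape, differing only by the power of $q$ that records the descents.\<close>

lemma open_chains_gf:
  fixes q :: "'a :: comm_semiring_1"
  assumes K: "\<And>b. \<forall>y\<in>set b. 0 < y \<Longrightarrow> finite (block_chains L b D) \<and>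
    (\<Sum>t\<in>block_chains L b D. q ^ weight t) =
       q ^ (s + length b + descent_weight 0 b) * gauss q (length b) L"
  and D: "\<forall>d\<in>set D. d < L" and b: "\<forall>y\<in>set b. 0 < y"
  shows "finite (open_chains L z b D) \<and>
    (\<Sum>(v, t)\<in>open_chains L z b D. q ^ weight t) =
       q ^ (s + descent_weight z b) * gauss q (length b) (Suc L)"
  using b
proof (induction b arbitrary: z)
  case Nil
  have "(\<Sum>(v, t)\<in>Pair [] ` block_chains L [] D. q ^ weight t) = (\<Sum>t\<in>block_chains L [] D. q ^ weight t)"
    by (subst sum.reindex) (auto simp: inj_on_def)
  then show ?case using K[of "[]"] by (simp add: open_chains_Nil)
next
  case (Cons y b)
  then have y: "0 < y"
    and J: "finite (open_chains L y b D)"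
      "(\<Sum>(v, t)\<in>open_chains L y b D. q ^ weight t) =
         q ^ (s + descent_weight y b) * gauss q (length b) (Suc L)"
    by auto
  have K': "finite (block_chains L (y # b) D)"
    "(\<Sum>t\<in>block_chains L (y # b) D. q ^ weight t) =
       q ^ (s + Suc (length b) + descent_weight y b) * gauss q (Suc (length b)) L"
    using K[of "y # b"] Cons.prems y by auto
  show ?case
  proof (cases "z < y")
    case True
    let ?f = "\<lambda>(v, t). (y # v, t) :: nat list \<times> block list"
    let ?w = "\<lambda>(v :: nat list, t). q ^ weight t"
    have disj: "Pair [] ` block_chains L (y # b) D \<inter> ?f ` open_chains L y b D = {}"
      by auto
    have 1: "sum ?w (?f ` open_chains L y b D) = sum ?w (open_chains L y b D)"
      by (subst sum.reindex) (auto simp: inj_on_def intro!: sum.cong)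
    have 2: "sum ?w (Pair [] ` block_chains L (y # b) D) = (\<Sum>t\<in>block_chains L (y # b) D. q ^ weight t)"
      by (subst sum.reindex) (auto simp: inj_on_def)
    have "sum ?w (open_chains L z (y # b) D)
      = q ^ (s + Suc (length b) + descent_weight y b) * gauss q (Suc (length b)) L
        + q ^ (s + descent_weight y b) * gauss q (length b) (Suc L)"
      unfolding open_chains_ascent[OF True]
      using disj K' J by (simp add: sum.union_disjoint 1 2)
    then show ?thesis
      using True K' J by (simp add: open_chains_ascent algebra_simps power_add)
  next
    case False
    note step = chains_gf_step[OF K' J D y]
    have "(\<Sum>(v, t)\<in>Pair [] ` block_chains (Suc L) (y # b) D. q ^ weight t)
        = (\<Sum>t\<in>block_chains (Suc L) (y # b) D. q ^ weight t)"
      by (subst sum.reindex) (auto simp: inj_on_def)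
    then show ?thesis
      using False step by (simp add: open_chains_descent[OF D] add.assoc)
  qed
qed

text \<open>The odd levels enter only through the factor $q^{\sum (d + 1)}$. The reason is that a block with
digit 0 moves all the letters after it one block further, and in return
saves the cost of a new block for the letters that join it; these effects correspond to the choice
between the two Pascal rules at that level.\<close>

lemma chains_gf:
  fixes q :: "'a :: comm_semiring_1"
  assumes "sorted_wrt (>) D" "\<forall>d\<in>set D. d < L" "\<forall>y\<in>set b. 0 < y"
  shows "finite (block_chains L b D) \<and>
    (\<Sum>t\<in>block_chains L b D. q ^ weight t) =
       q ^ (sum_list (map Suc D) + length b + descent_weight 0 b) * gauss q (length b) L"
  using assms
proof (induction L arbitrary: b D)
  case 0
  then show ?case by (cases b) (auto simp: chains_0)
next
  case (Suc L)
  show ?case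
  proof (cases "\<forall>d\<in>set D. d < L")
    case True
    have J: "finite (open_chains L z b D) \<and>
        (\<Sum>(v, t)\<in>open_chains L z b D. q ^ weight t) =
           q ^ (sum_list (map Suc D) + descent_weight z b) * gauss q (length b) (Suc L)"
      if "\<forall>k\<in>set b. 0 < k" for z b
      using Suc.IH[OF Suc.prems(1) True] True that by (rule open_chains_gf)
    show ?thesis
    proof (cases b)
      case Nil
      then show ?thesis
        using Suc.IH[OF Suc.prems(1) True, of "[]"] by (simp add: chains_Suc_Nil[OF True])
    next
      case (Cons y b')
      then have y: "0 < y" "\<forall>k\<in>set b'. 0 < k" using Suc.prems by auto
      have "finite (block_chains L (y # b') D)"
        "(\<Sum>t\<in>block_chains L (y # b') D. q ^ weight t) =
           q ^ (sum_list (map Suc D) + Suc (length b') + descent_weight y b') * gauss q (Suc (length b')) L"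
        using Suc.IH[OF Suc.prems(1) True Suc.prems(3)] y by (auto simp: Cons)
      moreover have "finite (open_chains L y b' D)"
        "(\<Sum>(v, t)\<in>open_chains L y b' D. q ^ weight t) =
           q ^ (sum_list (map Suc D) + descent_weight y b') * gauss q (length b') (Suc L)"
        using J[OF y(2), of y] by blast+
      ultimately have "finite (block_chains (Suc L) (y # b') D)"
        "(\<Sum>t\<in>block_chains (Suc L) (y # b') D. q ^ weight t) =
           q ^ (sum_list (map Suc D) + Suc (length b') + descent_weight y b')
             * gauss q (Suc (length b')) (Suc L)"
        by (rule chains_gf_step[OF _ _ _ _ True y(1)])+
      then show ?thesis using y(1) by (simp add: Cons del: gauss.simps)
    qed
  next
    case False
    then obtain D' where D: "D = L # D'"
      using Suc.prems(1,2) by (cases D) (auto simp: less_Suc_eq)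
    then have D': "sorted_wrt (>) D'" "\<forall>d\<in>set D'. d < L" using Suc.prems by auto
    \<comment> \<open>The largest odd level is \<open>L\<close>, and its block opens the chain.\<close>
    let ?f = "\<lambda>(v, t). (L, 0 # v) # t"
    let ?s = "sum_list (map Suc D')"
    have J: "finite (open_chains L 0 b D') \<and>
        (\<Sum>(v, t)\<in>open_chains L 0 b D'. q ^ weight t) =
           q ^ (?s + descent_weight 0 b) * gauss q (length b) (Suc L)"
      using Suc.IH[OF D'] D'(2) Suc.prems(3) by (rule open_chains_gf)
    have "(\<Sum>t\<in>?f ` open_chains L 0 b D'. q ^ weight t)
        = (\<Sum>p\<in>open_chains L 0 b D'. q ^ weight (?f p))"
      by (subst sum.reindex) (auto simp: inj_on_def)
    also have "\<dots> = (\<Sum>p\<in>open_chains L 0 b D'. q ^ (Suc L + length b) * (case p of (v, t) \<Rightarrow> q ^ weight t))"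
      by (rule sum.cong) (auto simp: open_chains_def power_add mult_ac)
    also have "\<dots> = q ^ (Suc L + length b) * (q ^ (?s + descent_weight 0 b) * gauss q (length b) (Suc L))"
      using J by (simp add: sum_distrib_left[symmetric])
    finally show ?thesis
      using J by (simp add: D chains_Suc_odd power_add mult_ac)
  qed
qed

section \<open>Lexicographically increasing lists with a given word of labels\<close>

text \<open>Lexicographically increasing lists of pairs (value, label) starting above \<open>(y, z)\<close>. The increments of
the values beyond the forced ones add up to at most \<open>L\<close>; this cap makes the sets finite and is
harmless for lists whose values are bounded by \<open>L + y\<close>.\<close>

fun capped :: "nat \<Rightarrow> nat \<Rightarrow> nat \<Rightarrow> (nat \<times> nat) list \<Rightarrow> bool" where
  "capped L y z [] \<longleftrightarrow> True"
| "capped L y z ((y', c) # ps) \<longleftrightarrow>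
     (\<exists>g\<le>L. y' = y + (if z < c then 0 else 1) + g \<and> capped (L - g) y' c ps)"

definition capped_lists :: "nat \<Rightarrow> nat \<Rightarrow> nat \<Rightarrow> nat list \<Rightarrow> (nat \<times> nat) list set" where
  "capped_lists L y z b = {ps. capped L y z ps \<and> map snd ps = b}"

lemma capped_lists_Cons:
  fixes y z c :: nat
  defines "e \<equiv> y + (if z < c then 0 else 1)"
  shows "capped_lists L y z (c # b) =
    (\<Union>g\<in>{..L}. Cons (e + g, c) ` capped_lists (L - g) (e + g) c b)"
proof (intro set_eqI iffI)
  fix ps assume "ps \<in> capped_lists L y z (c # b)"
  then show "ps \<in> (\<Union>g\<in>{..L}. Cons (e + g, c) ` capped_lists (L - g) (e + g) c b)"
    by (cases ps) (fastforce simp: capped_lists_def e_def image_iff)+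
qed (auto simp: capped_lists_def e_def)

text \<open>The excess increment \<open>g\<close> before the first letter is shared by all the values, which is the recursion
of the Gaussian coefficient by smallest elements. So lists with labels \<open>b\<close> and chains with word \<open>b\<close>
have the same generating function up to the contribution of the odd levels.\<close>

lemma capped_lists_gf:
  fixes q :: "'a :: comm_semiring_1"
  shows "finite (capped_lists L y z b) \<and>
    (\<Sum>ps\<in>capped_lists L y z b. q ^ sum_list (map fst ps)) =
      q ^ (y * length b + descent_weight z b) * gauss q (length b) (Suc L)"
proof (induction b arbitrary: L y z)
  case Nil
  have "capped_lists L y z [] = {[]}" by (auto simp: capped_lists_def)
  then show ?case by simp
next
  case (Cons c b)
  define e where "e = (if z < c then 0 else 1 :: nat)"
  let ?N = "length b"
  let ?F = "\<lambda>g. Cons (y + e + g, c) ` capped_lists (L - g) (y + e + g) c b"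
  have U: "capped_lists L y z (c # b) = (\<Union>g\<in>{..L}. ?F g)"
    by (simp only: capped_lists_Cons e_def)
  have fin: "finite (?F g)" for g using Cons.IH by simp
  have "(\<Sum>ps\<in>capped_lists L y z (c # b). q ^ sum_list (map fst ps))
      = (\<Sum>g\<le>L. \<Sum>ps\<in>?F g. q ^ sum_list (map fst ps))"
    unfolding U by (rule sum.UNION_disjoint) (use fin in auto)
  also have "\<dots> = (\<Sum>g\<le>L. q ^ (y * Suc ?N + e * Suc ?N + descent_weight c b) *
      (q ^ (g * Suc ?N) * gauss q ?N (Suc (L - g))))"
  proof (rule sum.cong)
    fix g
    have "(\<Sum>ps\<in>?F g. q ^ sum_list (map fst ps))
        = (\<Sum>ps\<in>capped_lists (L - g) (y + e + g) c b. q ^ (y + e + g) * q ^ sum_list (map fst ps))"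
      by (subst sum.reindex) (auto simp: power_add)
    also have "\<dots> = q ^ (y + e + g) *
        (q ^ ((y + e + g) * ?N + descent_weight c b) * gauss q ?N (Suc (L - g)))"
      using Cons.IH by (simp add: sum_distrib_left[symmetric])
    also have "\<dots> = q ^ (y * Suc ?N + e * Suc ?N + descent_weight c b) *
      (q ^ (g * Suc ?N) * gauss q ?N (Suc (L - g)))"
      unfolding mult.assoc[symmetric] power_add[symmetric] by (simp add: algebra_simps)
    finally show "(\<Sum>ps\<in>?F g. q ^ sum_list (map fst ps))
      = q ^ (y * Suc ?N + e * Suc ?N + descent_weight c b) *
      (q ^ (g * Suc ?N) * gauss q ?N (Suc (L - g)))" .
  qed simp
  also have "\<dots> = q ^ (y * Suc ?N + e * Suc ?N + descent_weight c b) * gauss q (Suc ?N) (Suc L)"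
    by (simp only: sum_distrib_left[symmetric] gauss_Suc_sum)
  finally show ?case using fin by (simp add: U e_def add.assoc del: gauss.simps)
qed

lemma capped_imp_sorted: "capped L y z ps \<Longrightarrow> sorted_wrt (<) ((y, z) # ps)"
proof (induction L y z ps rule: capped.induct)
  case (2 L y z y' c ps)
  then have "sorted_wrt (<) ((y', c) # ps)" by auto
  moreover have "(y, z) < (y', c)" using 2(2) by (auto split: if_splits)
  ultimately show ?case
    unfolding sorted_wrt.simps(2)[of _ "(y, z)"] by (auto simp del: less_prod_simp dest: less_trans)
qed simp

lemma sorted_imp_capped:
  "sorted_wrt (<) ((y, z) # ps) \<Longrightarrow> \<forall>p\<in>set ps. fst p \<le> L + y \<Longrightarrow> capped L y z ps"
proof (induction ps arbitrary: L y z)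
  case (Cons p ps)
  obtain y' c where p: "p = (y', c)" by force
  define e where "e = y + (if z < c then 0 else 1 :: nat)"
  have lt: "(y, z) < (y', c)" using Cons.prems p by simp
  then have e: "e \<le> y'" by (auto simp: e_def)
  have "e \<ge> y" by (simp add: e_def)
  have "capped (L - (y' - e)) y' c ps"
  proof (rule Cons.IH)
    show "sorted_wrt (<) ((y', c) # ps)" using Cons.prems p by simp
    have "y' \<le> L + y" using Cons.prems(2) p by simp
    then have "L + y \<le> L - (y' - e) + y'" using \<open>e \<ge> y\<close> e by linarith
    then show "\<forall>p\<in>set ps. fst p \<le> L - (y' - e) + y'" using Cons.prems(2) by fastforce
  qed
  moreover have "y' - e \<le> L" "y' = e + (y' - e)" using Cons.prems(2) p e \<open>e \<ge> y\<close> by auto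
  ultimately show ?case unfolding p capped.simps e_def by blast
qed simp

lemma coeff_gf:
  assumes "finite S"
  shows "coeff (\<Sum>s\<in>S. monom 1 1 ^ f s :: nat poly) m = card {s \<in> S. f s = m}"
proof -
  have "coeff (\<Sum>s\<in>S. monom 1 1 ^ f s :: nat poly) m = (\<Sum>s\<in>S. if f s = m then 1 else 0)"
    unfolding coeff_sum by (intro sum.cong) (simp_all add: monom_power)
  also have "\<dots> = card {s \<in> S. f s = m}"
    using assms by (simp add: sum.If_cases Int_def)
  finally show ?thesis .
qed

text \<open>Comparison of the coefficients of $q^m$. Levels of a chain of weight \<open>m\<close> and values in a list of sum at
most \<open>m\<close> do not exceed \<open>m\<close>, so the bounds in the two generating functions lose nothing. As the labels
are positive, lying above \<open>(1, 0)\<close> means that the values are positive.\<close>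

lemma card_fibre:
  assumes D: "sorted_wrt (>) D" "\<forall>d\<in>set D. d < Suc m" and b: "\<forall>y\<in>set b. 0 < y"
  shows "card {t \<in> block_chains (Suc m) b D. weight t = m} =
    card {ps. sorted_wrt (<) ((1, 0) # ps) \<and> map snd ps = b \<and>
      sum_list (map Suc D) + sum_list (map fst ps) = m}"
    and "finite {t \<in> block_chains (Suc m) b D. weight t = m}"
    and "finite {ps. sorted_wrt (<) ((1, 0) # ps) \<and> map snd ps = b \<and>
      sum_list (map Suc D) + sum_list (map fst ps) = m}"
proof -
  let ?q = "monom 1 1 :: nat poly"
  let ?s = "sum_list (map Suc D)"
  note A = capped_lists_gf[of m 1 0 b ?q]
  note B = chains_gf[OF D b, of ?q]
  have eq: "{ps. sorted_wrt (<) ((1, 0) # ps) \<and> map snd ps = b \<and> ?s + sum_list (map fst ps) = m}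
      = {ps \<in> capped_lists m 1 0 b. ?s + sum_list (map fst ps) = m}"
  proof (intro set_eqI iffI)
    fix ps
    assume "ps \<in> {ps. sorted_wrt (<) ((1, 0) # ps) \<and> map snd ps = b \<and> ?s + sum_list (map fst ps) = m}"
    then have ps: "sorted_wrt (<) ((1, 0) # ps)" "map snd ps = b" "?s + sum_list (map fst ps) = m"
      by auto
    have "fst p \<le> m + 1" if "p \<in> set ps" for p
      using member_le_sum_list[of "fst p" "map fst ps"] that ps(3) by auto
    then show "ps \<in> {ps \<in> capped_lists m 1 0 b. ?s + sum_list (map fst ps) = m}"
      using sorted_imp_capped[of 1 0 ps m] ps by (auto simp: capped_lists_def)
  next
    fix ps
    assume "ps \<in> {ps \<in> capped_lists m 1 0 b. ?s + sum_list (map fst ps) = m}"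
    then show "ps \<in> {ps. sorted_wrt (<) ((1, 0) # ps) \<and> map snd ps = b \<and> ?s + sum_list (map fst ps) = m}"
      using capped_imp_sorted[of m 1 0 ps] unfolding capped_lists_def by blast
  qed
  have "(\<Sum>ps\<in>capped_lists m 1 0 b. ?q ^ (?s + sum_list (map fst ps)))
      = (\<Sum>t\<in>block_chains (Suc m) b D. ?q ^ weight t)"
    using A B by (simp add: power_add sum_distrib_left[symmetric] algebra_simps)
  then have "coeff (\<Sum>ps\<in>capped_lists m 1 0 b. ?q ^ (?s + sum_list (map fst ps))) m
      = coeff (\<Sum>t\<in>block_chains (Suc m) b D. ?q ^ weight t) m"
    by simp
  then show "card {t \<in> block_chains (Suc m) b D. weight t = m} =
    card {ps. sorted_wrt (<) ((1, 0) # ps) \<and> map snd ps = b \<and> ?s + sum_list (map fst ps) = m}"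
    unfolding eq coeff_gf[OF conjunct1[OF A]] coeff_gf[OF conjunct1[OF B]] by simp
  show "finite {t \<in> block_chains (Suc m) b D. weight t = m}" using B by simp
  show "finite {ps. sorted_wrt (<) ((1, 0) # ps) \<and> map snd ps = b \<and>
      sum_list (map Suc D) + sum_list (map fst ps) = m}"
    unfolding eq using A by simp
qed

section \<open>Colored partitions as chains of blocks\<close>

fun parts :: "block list \<Rightarrow> cpart list" where
  "parts [] = []"
| "parts ((a, bs) # t) = (a + length bs + length (word t), set_encode (set bs)) # parts t"

definition wf_blocks :: "block list \<Rightarrow> bool" where
  "wf_blocks t \<longleftrightarrow> (\<forall>(a, bs)\<in>set t. bs \<noteq> [] \<and> sorted_wrt (<) bs)"

lemma wf_blocks_simps [simp]:
  "wf_blocks []"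
  "wf_blocks ((a, bs) # t) \<longleftrightarrow> bs \<noteq> [] \<and> sorted_wrt (<) bs \<and> wf_blocks t"
  by (auto simp: wf_blocks_def)

lemma binary_powers_eq: "binary_powers c = (\<lambda>k. 2 ^ k) ` set_decode c"
  by (auto simp: binary_powers_def set_decode_def bit_iff_odd)

lemma omega_eq: "omega c = card (set_decode c)"
  unfolding omega_def binary_powers_eq by (rule card_image) (simp add: inj_on_def)

lemma omega_pos: "0 < c \<Longrightarrow> 0 < omega c"
  using set_decode_inverse[of c] by (auto simp: omega_eq card_gt_0_iff set_encode_def)

lemma mono_power_2: "mono (\<lambda>k :: nat. 2 ^ k :: nat)"
  by (simp add: mono_def)

lemma delta_eq:
  assumes "c \<noteq> 0" "d \<noteq> 0"
  shows "delta c d = (if Max (set_decode c) < Min (set_decode d) then 1 else 0)"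
proof -
  have ne: "set_decode c \<noteq> {}" if "c \<noteq> 0" for c
    using set_decode_inverse[of c] that by (auto simp: set_encode_def)
  have "zmax c = 2 ^ Max (set_decode c)"
    unfolding zmax_def binary_powers_eq using ne[OF assms(1)]
    by (subst mono_Max_commute[OF mono_power_2]) auto
  moreover have "vmin d = 2 ^ Min (set_decode d)"
    unfolding vmin_def binary_powers_eq using ne[OF assms(2)]
    by (subst mono_Min_commute[OF mono_power_2]) auto
  ultimately show ?thesis by (simp add: delta_def)
qed

lemma sorted_bits:
  assumes "sorted_wrt (<) (bs :: nat list)"
  shows "distinct bs" "card (set bs) = length bs"
    "bs \<noteq> [] \<Longrightarrow> Max (set bs) = last bs" "bs \<noteq> [] \<Longrightarrow> Min (set bs) = hd bs"
    "bs \<noteq> [] \<Longrightarrow> set_encode (set bs) \<noteq> 0"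
proof -
  have s: "sorted bs" "distinct bs" using assms by (simp_all add: strict_sorted_iff)
  then show "distinct bs" "card (set bs) = length bs" by (simp_all add: distinct_card)
  show "Max (set bs) = last bs" if "bs \<noteq> []"
  proof (rule Max_eqI)
    fix k assume "k \<in> set bs"
    then show "k \<le> last bs"
      using s(1) that by (induction bs) auto
  qed (use that in auto)
  show "Min (set bs) = hd bs" if "bs \<noteq> []"
    using s(1) that by (cases bs) (auto intro!: Min_eqI)
  show "set_encode (set bs) \<noteq> 0" if "bs \<noteq> []"
    using set_encode_inverse[of "set bs"] that by (metis finite_set set_decode_zero set_empty)
qed

lemma omega_encode: "sorted_wrt (<) bs \<Longrightarrow> omega (set_encode (set bs)) = length bs"
  by (simp add: omega_eq sorted_bits)

lemma omega_e_encode: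
  assumes "sorted_wrt (<) bs"
  shows "omega_e (set_encode (set bs)) = length (filter (\<lambda>k. 0 < k) bs)"
proof -
  have "{p \<in> binary_powers (set_encode (set bs)). even p} = (\<lambda>k. 2 ^ k) ` set (filter (\<lambda>k. 0 < k) bs)"
    by (auto simp: binary_powers_eq)
  moreover have "card \<dots> = card (set (filter (\<lambda>k. 0 < k) bs))"
    by (rule card_image) (simp add: inj_on_def)
  ultimately show ?thesis
    unfolding omega_e_def using sorted_bits(1)[OF assms] by (simp add: distinct_card del: set_filter)
qed

lemma delta_encode:
  assumes "bs \<noteq> []" "sorted_wrt (<) bs" "bs' \<noteq> []" "sorted_wrt (<) bs'"
  shows "delta (set_encode (set bs)) (set_encode (set bs')) = (if last bs < hd bs' then 1 else 0)"
  using assms by (simp add: delta_eq sorted_bits)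

lemma odd_encode: "odd (set_encode (set bs)) \<longleftrightarrow> 0 \<in> set bs"
  by (simp add: even_set_encode_iff)

lemma encode_range:
  assumes "bs \<noteq> []" "sorted_wrt (<) bs"
  shows "set_encode (set bs) \<in> {1..2 ^ n - 1} \<longleftrightarrow> set bs \<subseteq> {..<n}"
proof
  assume l: "set_encode (set bs) \<in> {1..2 ^ n - 1}"
  show "set bs \<subseteq> {..<n}"
  proof
    fix k assume "k \<in> set bs"
    then have "2 ^ k \<le> set_encode (set bs)"
      using member_le_sum[of k "set bs" "\<lambda>k. 2 ^ k :: nat"] by (simp add: set_encode_def)
    also have "\<dots> < 2 ^ n" using l by (auto simp: le_eq_less_or_eq dest: le_imp_less_Suc)
    finally show "k \<in> {..<n}" by simp
  qed
next
  assume "set bs \<subseteq> {..<n}"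
  then have "set_encode (set bs) \<le> (\<Sum>k<n. 2 ^ k)"
    by (auto simp: set_encode_def intro: sum_mono2)
  also have "\<dots> = 2 ^ n - 1" using mask_eq_sum_exp_nat[of n] by (simp add: lessThan_def)
  finally show "set_encode (set bs) \<in> {1..2 ^ n - 1}"
    using sorted_bits(5)[OF assms(2,1)] by simp
qed

text \<open>The conditions on consecutive parts and on the smallest part, in a form suited to induction.\<close>

fun gaps :: "cpart list \<Rightarrow> bool" where
  "gaps [] \<longleftrightarrow> True"
| "gaps [(s, c)] \<longleftrightarrow> omega c \<le> s"
| "gaps ((s, c) # (s', c') # l) \<longleftrightarrow> s' + omega c + delta c c' \<le> s \<and> gaps ((s', c') # l)"

lemma gaps_iff:
  "gaps l \<longleftrightarrow> (l \<noteq> [] \<longrightarrow> fst (last l) \<ge> omega (snd (last l))) \<and>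
     (\<forall>i. i + 1 < length l \<longrightarrow>
        int (size_at l i) - int (size_at l (i + 1))
          \<ge> int (omega (color_at l i) + delta (color_at l i) (color_at l (i + 1))))"
proof (induction l rule: gaps.induct)
  case (3 s c s' c' l)
  have all: "(\<forall>i. P i) \<longleftrightarrow> P 0 \<and> (\<forall>i. P (Suc i))" for P
    by (metis nat.exhaust)
  show ?case
    unfolding gaps.simps 3 by (subst (2) all) auto
qed auto

lemma gaps_sorted:
  "gaps l \<Longrightarrow> \<forall>p\<in>set l. 0 < snd p \<Longrightarrow>
    sorted_wrt (\<lambda>p q. fst q < fst p) l \<and> (\<forall>p\<in>set l. 0 < fst p)"
proof (induction l rule: gaps.induct)
  case (2 s c)
  then show ?case using omega_pos[of c] by simp
next
  case (3 s c s' c' l)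
  then show ?case using omega_pos[of c] by (auto intro: less_trans)
qed simp

lemma B_set_eq:
  "B_set n x m = {l. (\<forall>p\<in>set l. snd p \<in> {1..2 ^ n - 1}) \<and> gaps l \<and> sum_list (map fst l) = m \<and>
     (\<forall>r\<in>{1..n}. length (filter (\<lambda>p. r - 1 \<in> set_decode (snd p)) l) = x r)}"
proof -
  have count: "card {i. i < length l \<and> 2 ^ (r - 1) \<in> binary_powers (color_at l i)}
      = length (filter (\<lambda>p. r - 1 \<in> set_decode (snd p)) l)" for r and l :: "cpart list"
    by (simp add: length_filter_conv_card binary_powers_eq inj_image_mem_iff inj_on_def)
  have "is_colored_partition n l \<and> distinct l \<longleftrightarrow> (\<forall>p\<in>set l. snd p \<in> {1..2 ^ n - 1})"
    if "gaps l" for l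
  proof
    assume c: "\<forall>p\<in>set l. snd p \<in> {1..2 ^ n - 1}"
    have s: "sorted_wrt (\<lambda>p q. fst q < fst p) l" "\<forall>p\<in>set l. 0 < fst p"
      using gaps_sorted[OF that] c by fastforce+
    have "sorted_wrt cpart_ge l"
      using s(1) by (rule sorted_wrt_mono_rel[rotated]) (simp add: cpart_ge_def)
    moreover have "distinct l" using s(1) by (induction l) auto
    ultimately show "is_colored_partition n l \<and> distinct l"
      using c s by (simp add: is_colored_partition_def)
  qed (auto simp: is_colored_partition_def)
  then show ?thesis unfolding B_set_def count using gaps_iff by auto
qed

text \<open>With $\lambda_i = a_i + \omega(c_i) + \sum_{j > i} \omega_e(c_j)$ the difference of two consecutive parts is
$a_i - a_{i+1} + \omega(c_i)$, less one if $c_{i+1}$ is odd. So the gap condition asks for a drop of the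
level by $\delta(c_i, c_{i+1})$, or by one if $c_{i+1}$ is odd, in which case $\delta$ vanishes.\<close>

lemma chain_iff_gaps:
  "block_chain (Suc a) 0 ((a, bs) # t) \<longleftrightarrow> wf_blocks ((a, bs) # t) \<and> gaps (parts ((a, bs) # t))"
proof (induction t arbitrary: a bs)
  case Nil
  show ?case by (auto simp: omega_encode)
next
  case (Cons p t)
  obtain a' bs' where p: "p = (a', bs')" by force
  show ?case
  proof (cases "wf_blocks [(a, bs), (a', bs')]")
    case True
    then have bs: "bs \<noteq> []" "sorted_wrt (<) bs" "bs' \<noteq> []" "sorted_wrt (<) bs'" by auto
    from bs(3,4) have len: "length bs' = length (filter (\<lambda>k. 0 < k) bs') + (if hd bs' = 0 then 1 else 0)"
      by (cases rule: block_cases) auto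
    have "block_chain (Suc a) 0 ((a, bs) # p # t) \<longleftrightarrow>
        a' + (if 0 < hd bs' \<and> hd bs' \<le> last bs then 0 else 1) \<le> a \<and> block_chain (Suc a') 0 ((a', bs') # t)"
      using bs p by auto
    also have "\<dots> \<longleftrightarrow> wf_blocks ((a, bs) # p # t) \<and> gaps (parts ((a, bs) # p # t))"
      unfolding Cons.IH[of a' bs']
      using bs len by (simp add: p omega_encode delta_encode) linarith
    finally show ?thesis .
  qed (auto simp: p)
qed

lemma sum_list_parts: "sum_list (map fst (parts t)) = weight t"
  by (induction t rule: parts.induct) auto

lemma chain_weight_iff:
  assumes "weight t = m"
  shows "block_chain (Suc m) 0 t \<longleftrightarrow> wf_blocks t \<and> gaps (parts t)"
proof (cases t)
  case (Cons p t')
  obtain a bs where p: "p = (a, bs)" by force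
  have "block_chain (Suc m) 0 t \<longleftrightarrow> block_chain (Suc a) 0 t"
    using assms by (auto simp: Cons p)
  then show ?thesis using chain_iff_gaps[of a bs t'] by (simp add: Cons p)
qed simp

lemma inj_parts: "wf_blocks t \<Longrightarrow> wf_blocks t' \<Longrightarrow> parts t = parts t' \<Longrightarrow> t = t'"
proof (induction t arbitrary: t')
  case Nil
  then show ?case by (cases t') auto
next
  case (Cons p t)
  obtain a bs where p: "p = (a, bs)" by force
  obtain a' bs' t'' where t': "t' = (a', bs') # t''"
    using Cons.prems p by (cases t') auto
  have "t = t''" using Cons p t' by auto
  moreover have "set bs = set bs'"
    using Cons.prems p t' by (simp add: set_encode_eq)
  then have "bs = bs'"
    using Cons.prems p t' by (simp add: strict_sorted_equal)
  ultimately show ?case using Cons.prems p t' by simp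
qed

text \<open>The level of each part is a natural number because a part is at least its own $\omega$ plus the next
part, and every part is at least the number of letters from it on.\<close>

lemma surj_parts:
  "gaps l \<Longrightarrow> \<forall>p\<in>set l. 0 < snd p \<Longrightarrow> \<exists>t. wf_blocks t \<and> parts t = l"
proof (induction l rule: gaps.induct)
  case 1
  then show ?case by (intro exI[of _ "[]"]) simp
next
  case (2 s c)
  define bs where "bs = sorted_list_of_set (set_decode c)"
  have bs: "sorted_wrt (<) bs" "set_encode (set bs) = c" by (simp_all add: bs_def)
  then have "bs \<noteq> []" "length bs \<le> s" using 2 omega_encode[of bs] by auto
  then show ?case using bs by (intro exI[of _ "[(s - length bs, bs)]"]) simp
next
  case (3 s c s' c' l)
  define bs where "bs = sorted_list_of_set (set_decode c)"
  have bs: "sorted_wrt (<) bs" "set_encode (set bs) = c" by (simp_all add: bs_def)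
  then have ne: "bs \<noteq> []" using 3 by auto
  from 3 obtain t where t: "wf_blocks t" "parts t = (s', c') # l" by auto
  have "length (word t) \<le> s'"
  proof (cases t rule: parts.cases)
    case (2 a bs t')
    have "length (filter (\<lambda>k. 0 < k) bs) \<le> a + length bs"
      by (rule trans_le_add2[OF length_filter_le])
    then show ?thesis using t(2) 2 by auto
  qed simp
  then have "length bs + length (word t) \<le> s"
    using 3 omega_encode[OF bs(1)] bs by simp
  then show ?case using bs ne t
    by (intro exI[of _ "(s - length bs - length (word t), bs) # t"]) simp
qed

lemma count_parts_pos:
  assumes "wf_blocks t" "0 < k"
  shows "length (filter (\<lambda>p. k \<in> set_decode (snd p)) (parts t)) = count_list (word t) k"
proof -
  have "count_list (filter (\<lambda>k. 0 < k) bs) k = (if k \<in> set bs then 1 else 0)"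
    if "sorted_wrt (<) bs" for bs :: "nat list"
    using sorted_bits(1)[OF that] assms(2) by (induction bs) auto
  with assms show ?thesis by (induction t rule: parts.induct) auto
qed

lemma count_parts_0:
  "length (filter (\<lambda>p. 0 \<in> set_decode (snd p)) (parts t)) = length (odd_levels t)"
  by (induction t rule: parts.induct) (auto simp: odd_encode)

lemma colors_parts:
  assumes "wf_blocks t" "1 \<le> n"
  shows "(\<forall>p\<in>set (parts t). snd p \<in> {1..2 ^ n - 1}) \<longleftrightarrow> set (word t) \<subseteq> {1..<n}"
  using assms
proof (induction t rule: parts.induct)
  case (2 a bs t)
  have "k < n \<longleftrightarrow> (0 < k \<longrightarrow> k < n)" for k
    using 2(3) by (cases "k = 0") auto
  then have "(\<forall>k\<in>set bs. k < n) \<longleftrightarrow> (\<forall>k\<in>set bs. 0 < k \<longrightarrow> k < n)"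
    by (intro ball_cong) simp_all
  then have "set bs \<subseteq> {..<n} \<longleftrightarrow> set (filter (\<lambda>k. 0 < k) bs) \<subseteq> {1..<n}"
    by (auto simp: subset_iff)
  then show ?case using 2 encode_range[of bs n] by simp
qed simp

lemma drop_parts: "drop i (parts t) = parts (drop i t)"
  by (induction t arbitrary: i rule: parts.induct) (auto simp: drop_Cons split: nat.split)

lemma length_parts [simp]: "length (parts t) = length t"
  by (induction t rule: parts.induct) auto

lemma sum_omega_e_parts:
  assumes "wf_blocks t"
  shows "(\<Sum>k\<in>{i..<length t}. omega_e (color_at (parts t) k)) = length (word (drop i t))"
proof -
  have "sum_list (map (omega_e \<circ> snd) (parts t)) = length (word t)" if "wf_blocks t" for t
    using that by (induction t rule: parts.induct) (auto simp: omega_e_encode)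
  moreover have "wf_blocks (drop i t)"
    using assms by (auto simp: wf_blocks_def dest: in_set_dropD)
  ultimately have "length (word (drop i t)) = sum_list (map (omega_e \<circ> snd) (drop i (parts t)))"
    by (simp add: drop_parts)
  also have "\<dots> = (\<Sum>k<length t - i. omega_e (color_at (parts t) (i + k)))"
    by (simp add: sum_list_sum_nth atLeast0LessThan)
  also have "\<dots> = (\<Sum>k\<in>{i..<length t}. omega_e (color_at (parts t) k))"
    by (rule sum.reindex_bij_witness[of _ "\<lambda>k. k - i" "\<lambda>k. i + k"]) auto
  finally show ?thesis ..
qed

lemma omega_e_sums_concat:
  assumes "i \<le> j" "j \<le> length l"
  shows "R + int (\<Sum>k\<in>{j..<length l}. omega_e (color_at l k))
             + int (\<Sum>k\<in>{i..<j}. omega_e (color_at l k))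
          = R + int (\<Sum>k\<in>{i..<length l}. omega_e (color_at l k))"
  unfolding sum.atLeastLessThan_concat[OF assms, symmetric] of_nat_add by (simp only: add_ac)

text \<open>Sizes decrease strictly, so the smallest odd part is the last one, and the pairwise congruences carry
its congruence to all the odd parts.\<close>

lemma congruence_conditions_iff:
  assumes "sorted_wrt (\<lambda>p q. fst q < fst p) l"
  shows "smallest_odd_cond R M l \<and> odd_pairs_cond M l \<longleftrightarrow>
    (\<forall>i<length l. odd (color_at l i) \<longrightarrow>
      [int (size_at l i) = R + int (\<Sum>k\<in>{i..<length l}. omega_e (color_at l k))] (mod int M))"
    (is "?L \<longleftrightarrow> (\<forall>i<length l. odd (color_at l i) \<longrightarrow> ?C i)")
proof
  assume L: ?L
  show "\<forall>i<length l. odd (color_at l i) \<longrightarrow> ?C i"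
  proof (intro allI impI)
    fix i assume i: "i < length l" "odd (color_at l i)"
    \<comment> \<open>The last odd part, which is also the smallest.\<close>
    define S where "S = Max {j. j < length l \<and> odd (color_at l j)}"
    have fin: "finite {j. j < length l \<and> odd (color_at l j)}" by simp
    have "S \<in> {j. j < length l \<and> odd (color_at l j)}"
      unfolding S_def by (rule Max_in[OF fin]) (use i in auto)
    then have S: "S < length l" "odd (color_at l S)" by auto
    have le: "j \<le> S" if "j < length l" "odd (color_at l j)" for j
      using Max_ge[OF fin] that by (auto simp: S_def)
    have "size_at l S \<le> size_at l j" if "j < length l" "odd (color_at l j)" for j
      using le[OF that] sorted_wrt_nth_less[OF assms, of j S] S
      by (cases "j = S") (auto intro: less_imp_le)
    then have CS: "?C S" using L S by (auto simp: smallest_odd_cond_def)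
    show "?C i"
    proof (cases "i = S")
      case False
      then have iS: "i < S" using le[OF i] by simp
      have "[int (size_at l i) = int (size_at l S) + int (\<Sum>k\<in>{i..<S}. omega_e (color_at l k))]
          (mod int M)"
        using L i S iS by (auto simp: odd_pairs_cond_def)
      moreover have "[int (size_at l S) + int (\<Sum>k\<in>{i..<S}. omega_e (color_at l k))
          = R + int (\<Sum>k\<in>{S..<length l}. omega_e (color_at l k))
             + int (\<Sum>k\<in>{i..<S}. omega_e (color_at l k))] (mod int M)"
        using CS by (rule cong_add) (rule cong_refl)
      moreover have "R + int (\<Sum>k\<in>{S..<length l}. omega_e (color_at l k))
             + int (\<Sum>k\<in>{i..<S}. omega_e (color_at l k))
          = R + int (\<Sum>k\<in>{i..<length l}. omega_e (color_at l k))"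
        using iS S by (intro omega_e_sums_concat) auto
      ultimately show ?thesis by (simp only: cong_def)
    qed (use CS in simp)
  qed
next
  assume C: "\<forall>i<length l. odd (color_at l i) \<longrightarrow> ?C i"
  have "odd_pairs_cond M l"
    unfolding odd_pairs_cond_def
  proof (intro allI impI, elim conjE)
    fix i j assume ij: "i < j" "j < length l" "odd (color_at l i)" "odd (color_at l j)"
    have "R + int (\<Sum>k\<in>{j..<length l}. omega_e (color_at l k))
             + int (\<Sum>k\<in>{i..<j}. omega_e (color_at l k))
          = R + int (\<Sum>k\<in>{i..<length l}. omega_e (color_at l k))"
      using ij by (intro omega_e_sums_concat) auto
    moreover have "[int (size_at l j) + int (\<Sum>k\<in>{i..<j}. omega_e (color_at l k))
          = R + int (\<Sum>k\<in>{j..<length l}. omega_e (color_at l k))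
             + int (\<Sum>k\<in>{i..<j}. omega_e (color_at l k))] (mod int M)"
      using C ij by (intro cong_add) auto
    moreover have "?C i" using C ij by auto
    ultimately show "[int (size_at l i) = int (size_at l j)
        + int (\<Sum>k\<in>{i..<j}. omega_e (color_at l k))] (mod int M)"
      by (simp only: cong_def)
  qed
  then show ?L using C by (auto simp: smallest_odd_cond_def)
qed

text \<open>For an odd part the sum of $\omega_e$ from it on is its size minus its level minus one, so the conditions
say that the odd levels, raised by one, are congruent to $R$.\<close>

lemma congruence_parts:
  assumes "wf_blocks t" "gaps (parts t)"
  shows "smallest_odd_cond R M (parts t) \<and> odd_pairs_cond M (parts t) \<longleftrightarrow>
    (\<forall>d\<in>set (odd_levels t). [int (Suc d) = R] (mod int M))"
proof -
  have pos: "\<forall>p\<in>set (parts t). 0 < snd p"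
  proof -
    have "0 < set_encode (set bs)" if "bs \<noteq> []" "sorted_wrt (<) bs" for bs :: "nat list"
      using sorted_bits(5)[OF that(2,1)] by simp
    then show ?thesis using assms(1) by (induction t rule: parts.induct) auto
  qed
  have nth: "parts t ! i = (fst (t ! i) + length (snd (t ! i)) + length (word (drop (Suc i) t)),
      set_encode (set (snd (t ! i))))" if "i < length t" for i
    using that
  proof (induction t arbitrary: i rule: parts.induct)
    case (2 a bs t)
    then show ?case by (cases i) auto
  qed simp
  have cong: "[int (size_at (parts t) i) = R + int (length (word (drop i t)))] (mod int M) \<longleftrightarrow>
      [int (Suc (fst (t ! i))) = R] (mod int M)"
    if i: "i < length t" "0 \<in> set (snd (t ! i))" for i
  proof -
    obtain a bs where ti: "t ! i = (a, bs)" by force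
    have d: "drop i t = (a, bs) # drop (Suc i) t"
      using i ti Cons_nth_drop_Suc[of i t] by simp
    have bs: "bs \<noteq> []" "sorted_wrt (<) bs"
      using assms(1) i ti nth_mem[of i t] by (auto simp: wf_blocks_def)
    then obtain v where "bs = 0 # v" "filter (\<lambda>k. 0 < k) bs = v"
      by (cases rule: block_cases) (use i ti in auto)
    then have "int (size_at (parts t) i) = int (Suc a) + int (length (word (drop i t)))"
      using nth[OF i(1)] ti d by simp
    then show ?thesis using ti by (simp only: cong_add_rcancel fst_conv)
  qed
  have levels: "set (odd_levels t) = {fst (t ! i) | i. i < length t \<and> 0 \<in> set (snd (t ! i))}"
  proof -
    have "d \<in> set (odd_levels t) \<longleftrightarrow> (\<exists>p\<in>set t. 0 \<in> set (snd p) \<and> d = fst p)" for d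
      by (induction t rule: odd_levels.induct) auto
    moreover have "(\<exists>p\<in>set t. P p) \<longleftrightarrow> (\<exists>i<length t. P (t ! i))" for P
      by (metis in_set_conv_nth)
    ultimately show ?thesis by auto
  qed
  have odd: "odd (color_at (parts t) i) \<longleftrightarrow> 0 \<in> set (snd (t ! i))" if "i < length t" for i
    using nth[OF that] by (simp only: snd_conv odd_encode)
  have "smallest_odd_cond R M (parts t) \<and> odd_pairs_cond M (parts t) \<longleftrightarrow>
      (\<forall>i<length t. odd (color_at (parts t) i) \<longrightarrow>
        [int (size_at (parts t) i) = R + int (length (word (drop i t)))] (mod int M))"
    using congruence_conditions_iff[OF conjunct1[OF gaps_sorted[OF assms(2) pos]], of R M]
    unfolding length_parts sum_omega_e_parts[OF assms(1)] .
  also have "\<dots> \<longleftrightarrow> (\<forall>i<length t. 0 \<in> set (snd (t ! i)) \<longrightarrow> [int (Suc (fst (t ! i))) = R] (mod int M))"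
    by (intro all_cong) (use odd cong in blast)
  also have "\<dots> \<longleftrightarrow> (\<forall>d\<in>set (odd_levels t). [int (Suc d) = R] (mod int M))"
    unfolding levels by blast
  finally show ?thesis .
qed

section \<open>Tuples of partitions as labelled lists\<close>

lemma distinct_partitions_eq:
  "distinct_partitions k = {p. sorted_wrt (>) p \<and> (\<forall>a\<in>set p. 0 < a) \<and> length p = k}"
proof -
  have "sorted_wrt (\<ge>) p \<and> distinct p \<longleftrightarrow> sorted_wrt (>) p" for p :: "nat list"
    using strict_sorted_iff[of "rev p"] by (simp add: sorted_wrt_rev)
  then show ?thesis by (auto simp: distinct_partitions_def is_partition_def)
qed

definition mu_tuples :: "int \<Rightarrow> nat \<Rightarrow> nat \<Rightarrow> (nat \<Rightarrow> nat) \<Rightarrow> nat \<Rightarrow> (nat \<Rightarrow> nat list) set" where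
  "mu_tuples R M n x m = {mu \<in> (\<Pi>\<^sub>E r\<in>{1..n}. distinct_partitions (x r)).
             (\<forall>a\<in>set (mu 1). [int a = R] (mod int M)) \<and>
             (\<Sum>r\<in>{1..n}. sum_list (mu r)) = m}"

text \<open>The tuples $(\mu_1, \ldots, \mu_n)$ in another form: \<open>D\<close> is $\mu_1$ with all parts lowered by one, and \<open>ps\<close>
merges the parts of $\mu_2, \ldots, \mu_n$ into one increasing list, a part of $\mu_r$ being labelled
$r - 1$, the exponent of $2^{r-1}$.\<close>

definition mixed_lists ::
  "int \<Rightarrow> nat \<Rightarrow> nat \<Rightarrow> (nat \<Rightarrow> nat) \<Rightarrow> nat \<Rightarrow> (nat list \<times> (nat \<times> nat) list) set" where
  "mixed_lists R M n x m = {(D, ps). sorted_wrt (>) D \<and> sorted_wrt (<) ((1, 0) # ps) \<and>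
     set (map snd ps) \<subseteq> {1..<n} \<and>
     length D = x 1 \<and> (\<forall>d\<in>set D. [int (Suc d) = R] (mod int M)) \<and>
     (\<forall>r\<in>{2..n}. count_list (map snd ps) (r - 1) = x r) \<and>
     sum_list (map Suc D) + sum_list (map fst ps) = m}"

definition unmix :: "nat \<Rightarrow> nat list \<times> (nat \<times> nat) list \<Rightarrow> nat \<Rightarrow> nat list" where
  "unmix n = (\<lambda>(D, ps). \<lambda>r\<in>{1..n}. if r = 1 then map Suc D
     else rev (map fst (filter (\<lambda>p. snd p = r - 1) ps)))"

lemma sum_filter_snd:
  fixes ps :: "(nat \<times> nat) list"
  assumes "set (map snd ps) \<subseteq> {1..<n}"
  shows "(\<Sum>r\<in>{2..n}. sum_list (map fst (filter (\<lambda>p. snd p = r - 1) ps))) = sum_list (map fst ps)"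
  using assms
proof (induction ps)
  case (Cons p ps)
  have "(\<Sum>r\<in>{2..n}. sum_list (map fst (filter (\<lambda>p. snd p = r - 1) (p # ps))))
      = (\<Sum>r\<in>{2..n}. (if r = Suc (snd p) then fst p else 0)
          + sum_list (map fst (filter (\<lambda>p. snd p = r - 1) ps)))"
    by (intro sum.cong) auto
  also have "\<dots> = fst p + sum_list (map fst ps)"
    using Cons by (simp add: sum.distrib)
  finally show ?case by simp
qed simp

text \<open>Pairs with equal labels are ordered by their values, strictly.\<close>

lemma sorted_column:
  assumes "sorted_wrt (<) (ps :: (nat \<times> nat) list)"
  shows "sorted_wrt (>) (rev (map fst (filter (\<lambda>p. snd p = k) ps)))"
proof -
  have "sorted_wrt (\<lambda>p p'. fst p < fst p') (filter (\<lambda>p. snd p = k) ps)"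
    by (rule sorted_wrt_mono_rel[OF _ sorted_wrt_filter[OF assms]]) auto
  then show ?thesis by (simp add: sorted_wrt_rev sorted_wrt_map)
qed

lemma unmix_in_iff:
  assumes "1 \<le> n" "sorted_wrt (>) D" "sorted_wrt (<) ((1, 0) # ps)" "set (map snd ps) \<subseteq> {1..<n}"
  shows "unmix n (D, ps) \<in> mu_tuples R M n x m \<longleftrightarrow> (D, ps) \<in> mixed_lists R M n x m"
proof -
  have n: "{1..n} = insert 1 {2..n}" using assms(1) by auto
  have 1: "map Suc D \<in> distinct_partitions (x 1) \<longleftrightarrow> length D = x 1"
    using assms(2) by (simp add: distinct_partitions_eq sorted_wrt_map)
  have pos: "0 < fst p" if "p \<in> set ps" for p
  proof -
    have "(1, 0) < p" using assms(3) that by simp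
    then show ?thesis by (cases p) auto
  qed
  have 2: "rev (map fst (filter (\<lambda>p. snd p = k) ps)) \<in> distinct_partitions l
      \<longleftrightarrow> count_list (map snd ps) k = l" for k l
  proof -
    have "length (filter (\<lambda>p. snd p = k) ps) = count_list (map snd ps) k"
      by (induction ps) auto
    then show ?thesis
      using sorted_column[of ps k] assms(3) pos by (auto simp: distinct_partitions_eq)
  qed
  have "unmix n (D, ps) \<in> (\<Pi>\<^sub>E r\<in>{1..n}. distinct_partitions (x r)) \<longleftrightarrow>
      length D = x 1 \<and> (\<forall>r\<in>{2..n}. count_list (map snd ps) (r - 1) = x r)"
  proof -
    have "unmix n (D, ps) 1 = map Suc D" using assms(1) by (simp add: unmix_def)
    moreover have "unmix n (D, ps) r = rev (map fst (filter (\<lambda>p. snd p = r - 1) ps))"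
      if "r \<in> {2..n}" for r
      using that by (simp add: unmix_def)
    moreover have "unmix n (D, ps) \<in> extensional {1..n}" by (simp add: unmix_def)
    ultimately show ?thesis
      unfolding PiE_iff n by (simp only: ball_simps 1 2 simp_thms cong: ball_cong)
  qed
  moreover have "unmix n (D, ps) 1 = map Suc D"
    using assms(1) by (simp add: unmix_def)
  moreover have "(\<Sum>r\<in>{1..n}. sum_list (unmix n (D, ps) r))
      = sum_list (map Suc D) + sum_list (map fst ps)"
  proof -
    have "(\<Sum>r\<in>{2..n}. sum_list (unmix n (D, ps) r))
        = (\<Sum>r\<in>{2..n}. sum_list (map fst (filter (\<lambda>p. snd p = r - 1) ps)))"
      by (intro sum.cong) (auto simp: unmix_def sum_list_rev)
    then show ?thesis
      unfolding n sum_filter_snd[OF assms(4)] using assms(1) by (simp add: unmix_def)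
  qed
  ultimately show ?thesis
    using assms by (auto simp: mu_tuples_def mixed_lists_def)
qed

lemma descending_unique:
  assumes "sorted_wrt (>) p" "sorted_wrt (>) p'" "set p = set (p' :: nat list)"
  shows "p = p'"
  using strict_sorted_equal[of "rev p" "rev p'"] assms by (simp add: sorted_wrt_rev)

text \<open>An increasing list is determined by its set of pairs, and this set is read off from the tuple.\<close>

lemma bij_unmix:
  assumes "1 \<le> n"
  shows "bij_betw (unmix n) (mixed_lists R M n x m) (mu_tuples R M n x m)"
  unfolding bij_betw_def
proof (intro conjI)
  show "inj_on (unmix n) (mixed_lists R M n x m)"
  proof (rule inj_onI, clarify)
    fix D ps D' ps'
    assume in1: "(D, ps) \<in> mixed_lists R M n x m" and in2: "(D', ps') \<in> mixed_lists R M n x m"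
      and eq: "unmix n (D, ps) = unmix n (D', ps')"
    have "map Suc D = map Suc D'"
      using fun_cong[OF eq, of 1] assms by (simp add: unmix_def)
    then have "D = D'" by (simp add: inj_map_eq_map)
    moreover have "set ps = set ps'"
    proof -
      have mem: "(y, k) \<in> set ps \<longleftrightarrow> k \<in> {1..<n} \<and> y \<in> set (unmix n (D, ps) (Suc k))"
        if "(D, ps) \<in> mixed_lists R M n x m" for D ps y k
        using that by (auto simp: mixed_lists_def unmix_def image_iff)
      show ?thesis
        using mem[OF in1] mem[OF in2] eq by (auto simp: set_eq_iff)
    qed
    then have "ps = ps'"
      using in1 in2 by (intro strict_sorted_equal) (auto simp: mixed_lists_def)
    ultimately show "D = D' \<and> ps = ps'" by simp
  qed
  show "unmix n ` mixed_lists R M n x m = mu_tuples R M n x m"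
  proof (intro set_eqI iffI)
    fix mu assume "mu \<in> unmix n ` mixed_lists R M n x m"
    then obtain D ps where "mu = unmix n (D, ps)" "(D, ps) \<in> mixed_lists R M n x m" by force
    moreover from this(2) have "sorted_wrt (>) D" "sorted_wrt (<) ((1, 0) # ps)"
      "set (map snd ps) \<subseteq> {1..<n}" by (auto simp: mixed_lists_def)
    ultimately show "mu \<in> mu_tuples R M n x m"
      using unmix_in_iff[OF assms] by simp
  next
    fix mu assume mu: "mu \<in> mu_tuples R M n x m"
    then have ext: "mu \<in> extensional {1..n}" and mu_r: "\<And>r. r \<in> {1..n} \<Longrightarrow>
        sorted_wrt (>) (mu r) \<and> (\<forall>a\<in>set (mu r). 0 < a)"
      by (auto simp: mu_tuples_def PiE_iff distinct_partitions_eq)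
    define D where "D = map (\<lambda>a. a - 1) (mu 1)"
    define Y where "Y = (\<Union>k\<in>{1..<n}. (\<lambda>y. (y, k)) ` set (mu (Suc k)))"
    define ps where "ps = sorted_list_of_set Y"
    have ps: "sorted_wrt (<) ps" "set ps = Y" by (simp_all add: ps_def Y_def)
    have mu1: "sorted_wrt (>) (mu 1)" "\<forall>a\<in>set (mu 1). 0 < a" using mu_r assms by auto
    have SD: "map Suc D = mu 1"
      using mu1(2) by (simp add: D_def map_idI)
    have D: "sorted_wrt (>) D"
      using mu1(1) unfolding SD[symmetric] by (simp add: sorted_wrt_map)
    have ps1: "sorted_wrt (<) ((1, 0) # ps)" "set (map snd ps) \<subseteq> {1..<n}"
    proof -
      have "(1, 0) < p \<and> snd p \<in> {1..<n}" if mem: "p \<in> set ps" for p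
      proof -
        obtain y k where p: "p = (y, k)" "k \<in> {1..<n}" "y \<in> set (mu (Suc k))"
          using mem ps(2) by (auto simp: Y_def)
        then have "0 < y" using mu_r[of "Suc k"] by auto
        then show ?thesis using p by auto
      qed
      then show "sorted_wrt (<) ((1, 0) # ps)" "set (map snd ps) \<subseteq> {1..<n}"
        using ps(1) unfolding sorted_wrt.simps set_map by blast+
    qed
    have "rev (map fst (filter (\<lambda>p. snd p = r - 1) ps)) = mu r" if "r \<in> {2..n}" for r
    proof (rule descending_unique[OF sorted_column[OF ps(1)]])
      show "sorted_wrt (>) (mu r)" using mu_r that by auto
      have "(y, r - 1) \<in> Y \<longleftrightarrow> y \<in> set (mu r)" for y
        using that by (force simp: Y_def)
      then show "set (rev (map fst (filter (\<lambda>p. snd p = r - 1) ps))) = set (mu r)"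
        unfolding ps(2)[symmetric] by (force simp: image_iff)
    qed
    then have "unmix n (D, ps) = mu"
      using ext SD by (intro extensionalityI[of _ "{1..n}"]) (auto simp: unmix_def)
    moreover have "(D, ps) \<in> mixed_lists R M n x m"
      using unmix_in_iff[OF assms D ps1] mu calculation by simp
    ultimately show "mu \<in> unmix n ` mixed_lists R M n x m" by force
  qed
qed

section \<open>Comparison of the two counts\<close>

definition colored_chains :: "int \<Rightarrow> nat \<Rightarrow> nat \<Rightarrow> (nat \<Rightarrow> nat) \<Rightarrow> nat \<Rightarrow> block list set" where
  "colored_chains R M n x m = {t. block_chain (Suc m) 0 t \<and> weight t = m \<and> set (word t) \<subseteq> {1..<n} \<and>
     length (odd_levels t) = x 1 \<and> (\<forall>d\<in>set (odd_levels t). [int (Suc d) = R] (mod int M)) \<and>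
     (\<forall>r\<in>{2..n}. count_list (word t) (r - 1) = x r)}"

lemma bij_parts:
  assumes "1 \<le> n"
  shows "bij_betw parts (colored_chains R M n x m)
    {l \<in> B_set n x m. smallest_odd_cond R M l \<and> odd_pairs_cond M l}" (is "bij_betw _ _ ?B")
  unfolding bij_betw_def
proof (intro conjI)
  have n: "{1..n} = insert 1 {2..n}" using assms by auto
  have iff: "parts t \<in> ?B \<longleftrightarrow> t \<in> colored_chains R M n x m" if t: "wf_blocks t" for t
  proof -
    have "(\<forall>r\<in>{1..n}. length (filter (\<lambda>p. r - 1 \<in> set_decode (snd p)) (parts t)) = x r) \<longleftrightarrow>
        length (odd_levels t) = x 1 \<and> (\<forall>r\<in>{2..n}. count_list (word t) (r - 1) = x r)"
    proof -
      have "length (filter (\<lambda>p. r - 1 \<in> set_decode (snd p)) (parts t)) = count_list (word t) (r - 1)"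
        if "r \<in> {2..n}" for r
        using count_parts_pos[OF t, of "r - 1"] that by simp
      then show ?thesis
        using count_parts_0[of t] unfolding n by (simp del: set_decode_0)
    qed
    then show ?thesis
      using colors_parts[OF t assms] congruence_parts[OF t] chain_weight_iff[of t m] t
      unfolding B_set_eq colored_chains_def mem_Collect_eq sum_list_parts by blast
  qed
  have wf: "wf_blocks t" if "t \<in> colored_chains R M n x m" for t
    using chain_weight_iff[of t m] that by (auto simp: colored_chains_def)
  show "inj_on parts (colored_chains R M n x m)"
    using wf inj_parts by (blast intro: inj_onI)
  show "parts ` colored_chains R M n x m = ?B"
  proof (intro set_eqI iffI)
    fix l assume l: "l \<in> ?B"
    then have "gaps l" "\<forall>p\<in>set l. 0 < snd p" unfolding B_set_eq by force+
    then obtain t where "wf_blocks t" "parts t = l" using surj_parts by blast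
    then show "l \<in> parts ` colored_chains R M n x m" using iff l by blast
  qed (use wf iff in blast)
qed

lemma card_eq_fibres:
  assumes "\<And>k. card {a \<in> A. f a = k} = card {b \<in> B. g b = k}"
    and "\<And>k. finite {a \<in> A. f a = k}" "\<And>k. finite {b \<in> B. g b = k}"
  shows "card A = card B"
proof -
  have "\<exists>h. \<forall>k. bij_betw (h k) {a \<in> A. f a = k} {b \<in> B. g b = k}"
    using finite_same_card_bij[OF assms(2,3,1)] by (intro choice) blast
  then obtain h where h: "\<And>k. bij_betw (h k) {a \<in> A. f a = k} {b \<in> B. g b = k}" by blast
  have "bij_betw (\<lambda>a. h (f a) a) A B"
  proof (rule bij_betw_imageI)
    have gh: "h (f a) a \<in> B" "g (h (f a) a) = f a" if "a \<in> A" for a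
      using bij_betwE[OF h[of "f a"]] that by auto
    show "inj_on (\<lambda>a. h (f a) a) A"
    proof (rule inj_onI)
      fix a a' assume a: "a \<in> A" "a' \<in> A" "h (f a) a = h (f a') a'"
      then have "f a = f a'" using gh by metis
      then show "a = a'"
        using a bij_betw_imp_inj_on[OF h[of "f a"]] by (auto dest: inj_onD)
    qed
    have "b \<in> (\<lambda>a. h (f a) a) ` A" if "b \<in> B" for b
    proof -
      have "b \<in> h (g b) ` {a \<in> A. f a = g b}"
        using bij_betw_imp_surj_on[OF h[of "g b"]] that by blast
      then obtain a where "b = h (g b) a" "a \<in> A" "f a = g b" by blast
      then show ?thesis by (intro image_eqI[of _ _ a]) simp_all
    qed
    then show "(\<lambda>a. h (f a) a) ` A = B" using gh by auto
  qed
  then show ?thesis by (rule bij_betw_same_card)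
qed

text \<open>Both sides are sorted by the odd levels and the word; the congruences and the numbers of colors
containing a given power of 2 depend on these two data only.\<close>

lemma card_mixed_lists: "card (colored_chains R M n x m) = card (mixed_lists R M n x m)"
proof (rule card_eq_fibres[where f = "\<lambda>t. (odd_levels t, word t)" and g = "\<lambda>(D, ps). (D, map snd ps)"])
  fix Db :: "nat list \<times> nat list"
  obtain D b where Db: "Db = (D, b)" by force
  let ?C = "{t \<in> colored_chains R M n x m. (odd_levels t, word t) = Db}"
  let ?A = "{s \<in> mixed_lists R M n x m. (case s of (D, ps) \<Rightarrow> (D, map snd ps)) = Db}"
  have "card ?C = card ?A \<and> finite ?C \<and> finite ?A"
  proof (cases "sorted_wrt (>) D \<and> (\<forall>d\<in>set D. d < Suc m) \<and> set b \<subseteq> {1..<n} \<and>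
      length D = x 1 \<and> (\<forall>d\<in>set D. [int (Suc d) = R] (mod int M)) \<and>
      (\<forall>r\<in>{2..n}. count_list b (r - 1) = x r)")
    case True
    then have b: "\<forall>y\<in>set b. 0 < y" by auto
    let ?P = "{ps. sorted_wrt (<) ((1, 0) # ps) \<and> map snd ps = b \<and>
      sum_list (map Suc D) + sum_list (map fst ps) = m}"
    have C: "?C = {t \<in> block_chains (Suc m) b D. weight t = m}"
      using True by (auto simp: Db colored_chains_def block_chains_def)
    have A: "?A = Pair D ` ?P"
      using True by (auto simp: Db mixed_lists_def simp del: set_map)
    have "card ?A = card ?P" unfolding A by (rule card_image) (simp add: inj_on_def)
    then show ?thesis
      using card_fibre[of D m b] True b unfolding C A by simp
  next
    case False
    have "?C = {}"
      using False odd_levels_chain[of "Suc m" 0] by (auto simp: Db colored_chains_def)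
    \<comment> \<open>An odd level above \<open>m\<close> would make the sum too large on the other side as well.\<close>
    moreover have "d < Suc m" if "sum_list (map Suc D) + k = m" "d \<in> set D" for d k
      using member_le_sum_list[of "Suc d" "map Suc D"] that by auto
    then have "?A = {}"
      using False by (auto simp: Db mixed_lists_def)
    ultimately show ?thesis by (simp only: card.empty finite.emptyI simp_thms)
  qed
  then show "card ?C = card ?A" "finite ?C" "finite ?A" by auto
qed

theorem theorem3:
  fixes n M m :: nat and R :: int and x :: "nat \<Rightarrow> nat"
  assumes "n \<ge> 1" and "M \<ge> 1"
  shows "A_RM R M n x m = B_RM R M n x m"
proof -
  have "A_RM R M n x m = card (mixed_lists R M n x m)"
    using bij_betw_same_card[OF bij_unmix[OF assms(1)]]
    by (simp add: A_RM_def mu_tuples_def)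
  also have "\<dots> = card (colored_chains R M n x m)" by (simp add: card_mixed_lists)
  also have "\<dots> = B_RM R M n x m"
    using bij_betw_same_card[OF bij_parts[OF assms(1)]] by (simp add: B_RM_def)
  finally show ?thesis .
qed

end
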